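(* If $G$ is an IYB group, then every Hall subgroup of $G$ is also an IYB group.
   Context: $\mathrm{Fa}_n$ is the free abelian group (written multiplicatively) with basis $u_1,\dots,u_n$, and $\mathrm{Fa}_n\rtimes \mathrm{Sym}_n$ is the semidirect product for the natural action $\sigma(u_i)=u_{\sigma(i)}$, where $\mathrm{Sym}_n$ is the symmetric group of degree $n$. A finite group $G$ is an involutive Yang-Baxter (IYB) group if for some positive integer $n$ there is a map $\phi:\mathrm{Fa}_n\to \mathrm{Sym}_n$ such that $\{(a,\phi(a)) : a\in \mathrm{Fa}_n\}$ is a subgroup of $\mathrm{Fa}_n\rtimes \mathrm{Sym}_n$ and $G\cong\phi(\mathrm{Fa}_n)$. A Hall subgroup of a finite group is a subgroup whose order is coprime to its index. *)

theory Defs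
  imports "HOL-Algebra.Algebra"
begin

definition semidirect_product ::
  "('a, 'm) monoid_scheme \<Rightarrow> ('b, 'k) monoid_scheme \<Rightarrow> ('b \<Rightarrow> 'a \<Rightarrow> 'a) \<Rightarrow> ('a \<times> 'b) monoid"
  where "semidirect_product N Q \<theta> =
    \<lparr>carrier = carrier N \<times> carrier Q,
     monoid.mult = (\<lambda>(a, s) (b, t). (a \<otimes>\<^bsub>N\<^esub> \<theta> s b, s \<otimes>\<^bsub>Q\<^esub> t)),
     one = (\<one>\<^bsub>N\<^esub>, \<one>\<^bsub>Q\<^esub>)\<rparr>"

(* The basis element u_i is frag_of i. The library writes the free abelian group additively. *)
abbreviation Fa :: "nat \<Rightarrow> (nat \<Rightarrow>\<^sub>0 int) monoid"
  where "Fa n \<equiv> free_Abelian_group {1..n}"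

(* The endomorphism determined by u_i \<mapsto> u_(\<sigma> i). *)
definition basis_action :: "(nat \<Rightarrow> nat) \<Rightarrow> (nat \<Rightarrow>\<^sub>0 int) \<Rightarrow> (nat \<Rightarrow>\<^sub>0 int)"
  where "basis_action \<sigma> = frag_extend (\<lambda>i. frag_of (\<sigma> i))"

definition Fa_semidirect_Sym :: "nat \<Rightarrow> ((nat \<Rightarrow>\<^sub>0 int) \<times> (nat \<Rightarrow> nat)) monoid"
  where "Fa_semidirect_Sym n = semidirect_product (Fa n) (sym_group n) basis_action"

lemma basis_action_frag_of [simp]: "basis_action \<sigma> (frag_of i) = frag_of (\<sigma> i)"
  by (simp add: basis_action_def)

lemma basis_action_add: "basis_action \<sigma> (a + b) = basis_action \<sigma> a + basis_action \<sigma> b"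
  by (simp add: basis_action_def frag_extend_add)

lemma basis_action_diff: "basis_action \<sigma> (a - b) = basis_action \<sigma> a - basis_action \<sigma> b"
  by (simp add: basis_action_def frag_extend_diff)

lemma basis_action_0 [simp]: "basis_action \<sigma> 0 = 0"
  by (simp add: basis_action_def)

lemma basis_action_id [simp]: "basis_action id a = a"
  using subset_UNIV[of "Poly_Mapping.keys a"]
  by (induction a rule: frag_induction) (simp_all add: basis_action_diff)

lemma basis_action_comp: "basis_action (\<sigma> \<circ> \<tau>) a = basis_action \<sigma> (basis_action \<tau> a)"
  using subset_UNIV[of "Poly_Mapping.keys a"]
  by (induction a rule: frag_induction) (simp_all add: basis_action_diff)

lemma basis_action_closed:
  assumes "\<sigma> permutes {1..n}" "a \<in> carrier (Fa n)"
  shows "basis_action \<sigma> a \<in> carrier (Fa n)"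
proof -
  have "Poly_Mapping.keys a \<subseteq> {1..n}" using assms(2) by simp
  then have "Poly_Mapping.keys (basis_action \<sigma> a) \<subseteq> {1..n}"
  proof (induction a rule: frag_induction)
    case (one x)
    then have "\<sigma> x \<in> {1..n}" by (simp only: permutes_in_image[OF assms(1)])
    then show ?case by simp
  next
    case (diff a b)
    then show ?case unfolding basis_action_diff by (meson Un_least keys_diff order.trans)
  qed simp
  then show ?thesis by simp
qed

lemma group_Fa_semidirect_Sym: "group (Fa_semidirect_Sym n)"
proof (rule groupI)
  fix x assume "x \<in> carrier (Fa_semidirect_Sym n)"
  then obtain a s where x: "x = (a, s)" "a \<in> carrier (Fa n)" "s permutes {1..n}"
    by (auto simp: Fa_semidirect_Sym_def semidirect_product_def sym_group_carrier)
  define t where "t = Hilbert_Choice.inv s"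
  have t: "t permutes {1..n}" "t \<circ> s = id"
    using x(3) permutes_inv permutes_inv_o(2) by (auto simp: t_def)
  have "basis_action t (- a) \<in> carrier (Fa n)"
    using x(2) by (intro basis_action_closed t) simp
  moreover have "basis_action t (- a) + basis_action t a = 0"
    by (simp flip: basis_action_add)
  ultimately show "\<exists>y\<in>carrier (Fa_semidirect_Sym n). y \<otimes>\<^bsub>Fa_semidirect_Sym n\<^esub> x = \<one>\<^bsub>Fa_semidirect_Sym n\<^esub>"
    using t x by (intro bexI[of _ "(basis_action t (- a), t)"])
      (auto simp: Fa_semidirect_Sym_def semidirect_product_def sym_group_def)
next
  fix x y
  assume "x \<in> carrier (Fa_semidirect_Sym n)" "y \<in> carrier (Fa_semidirect_Sym n)"
  then obtain a s b t where
    x: "x = (a, s)" "a \<in> carrier (Fa n)" "s permutes {1..n}" and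
    y: "y = (b, t)" "b \<in> carrier (Fa n)" "t permutes {1..n}"
    by (auto simp: Fa_semidirect_Sym_def semidirect_product_def sym_group_carrier)
  have "a \<otimes>\<^bsub>Fa n\<^esub> basis_action s b \<in> carrier (Fa n)"
    using x y basis_action_closed by (intro monoid.m_closed group.is_monoid) auto
  then show "x \<otimes>\<^bsub>Fa_semidirect_Sym n\<^esub> y \<in> carrier (Fa_semidirect_Sym n)"
    using x y permutes_compose
    by (auto simp: Fa_semidirect_Sym_def semidirect_product_def sym_group_def)
qed (auto simp: Fa_semidirect_Sym_def semidirect_product_def sym_group_def
      basis_action_add basis_action_comp comp_assoc add.assoc)

definition IYB_group :: "('a, 'm) monoid_scheme \<Rightarrow> bool"
  where "IYB_group G \<longleftrightarrow>
    group G \<and> finite (carrier G) \<and>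
    (\<exists>n > 0. \<exists>\<phi> \<in> carrier (Fa n) \<rightarrow> carrier (sym_group n).
       subgroup {(a, \<phi> a) | a. a \<in> carrier (Fa n)} (Fa_semidirect_Sym n) \<and>
       G \<cong> (sym_group n)\<lparr>carrier := \<phi> ` carrier (Fa n)\<rparr>)"

definition Hall_subgroup :: "'a set \<Rightarrow> ('a, 'm) monoid_scheme \<Rightarrow> bool"
  where "Hall_subgroup H G \<longleftrightarrow>
    finite (carrier G) \<and> subgroup H G \<and> coprime (card H) (card (rcosets\<^bsub>G\<^esub> H))"

end

theory Submission
  imports Defs
begin

text \<open>
  Being an IYB group amounts to having a bijective crossed homomorphism (1-cocycle)
  \<open>c\<close> onto an abelian group \<open>A\<close>, that is \<open>c (g h) = c g \<cdot> g (c h)\<close> for an action of the group on \<open>A\<close>.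
  Given \<open>\<phi>\<close> as in the definition, the fibre \<open>K\<close> of \<open>\<phi>\<close> over the identity is an invariant subgroup of the
  free abelian group, the fibres of \<open>\<phi>\<close> are the cosets of \<open>K\<close>, and the inverse of \<open>\<phi>\<close> is a bijective
  crossed homomorphism onto the quotient \<open>A\<close> by \<open>K\<close>.

  Now let \<open>H\<close> be a Hall subgroup of order \<open>m\<close> and index \<open>k\<close>. As \<open>A\<close> has order \<open>m k\<close> with \<open>m\<close>, \<open>k\<close> coprime,
  it is the product of its \<open>m\<close>-torsion and its \<open>k\<close>-torsion, and raising to the power \<open>k\<close> is, up to an
  automorphism, the projection to the former. The map \<open>h \<mapsto> (c h)\<^sup>k\<close> is again a crossed homomorphism,
  because taking powers commutes with the action. Its kernel on \<open>H\<close> is the intersection of \<open>H\<close> with the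
  subgroup \<open>c\<inverse>(k-torsion)\<close>, whose order is prime to \<open>m\<close>; so it is injective on \<open>H\<close>, and
  counting makes it a bijection from \<open>H\<close> to the group of \<open>k\<close>-th powers
  (\<open>bij_betw_pow_index_Hall\<close>).

  Going back to the definition requires a map from a free abelian group to permutations of its basis.
  The original basis still serves: composing the projection from the free abelian group to \<open>A\<close> with the
  \<open>k\<close>-th power gives an equivariant map onto the group of \<open>k\<close>-th powers, and \<open>H\<close> inherits a faithful
  permutation action on the basis. The locale \<open>IYB_cocycle\<close> carries these data along with \<open>c\<close>.
\<close>

section \<open>Finite groups of bounded exponent\<close>

text \<open>
  A prime dividing the order is the order of some element (Cauchy's theorem, here from Sylow's), and
  so it divides every exponent.
\<close>
lemma (in group) coprime_order_if_exponent:
  assumes fin: "finite (carrier G)"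
    and exp: "\<And>x. x \<in> carrier G \<Longrightarrow> x [^] (e::nat) = \<one>"
    and cop: "coprime e k"
  shows "coprime (order G) k"
proof (rule ccontr)
  assume "\<not> coprime (order G) k"
  then obtain p where p: "Factorial_Ring.prime p" "p dvd order G" "p dvd k"
    by (metis coprime_iff_gcd_eq_1 gcd_greatest_iff prime_factor_nat)
  then obtain m where "order G = p ^ 1 * m" by (auto elim: dvdE)
  then obtain P where P: "subgroup P G" "card P = p"
    using sylow_thm[OF p(1) is_group _ fin] by fastforce
  have "P \<noteq> {\<one>}" using P(2) p(1) by auto
  then obtain x where x: "x \<in> P" "x \<noteq> \<one>"
    using subgroup.one_closed[OF P(1)] by blast
  then have xG: "x \<in> carrier G" using subgroup.mem_carrier[OF P(1)] by blast
  interpret P: group "G\<lparr>carrier := P\<rparr>" by (rule subgroup_imp_group[OF P(1)])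
  have "x [^]\<^bsub>G\<lparr>carrier := P\<rparr>\<^esub> card P = \<one>\<^bsub>G\<lparr>carrier := P\<rparr>\<^esub>"
    using P.pow_order_eq_1[of x] x(1) by (simp add: order_def)
  then have "x [^] p = \<one>" using P(2) by (simp add: nat_pow_consistent[symmetric])
  then have "ord x dvd p" using pow_eq_id[OF xG] by blast
  moreover have "ord x \<noteq> 1" using ord_eq_1[OF xG] x(2) by blast
  ultimately have "ord x = p" using p(1) by (auto simp: prime_nat_iff)
  moreover have "ord x dvd e" using exp[OF xG] pow_eq_id[OF xG] by blast
  ultimately have "p dvd e" by simp
  then show False using cop p(1,3) by (meson coprime_common_divisor not_prime_unit)
qed

section \<open>Crossed homomorphisms\<close>

locale crossed_hom = G: group G + A: comm_group A
  for G :: "('g, 'm) monoid_scheme" and A :: "('a, 'k) monoid_scheme" +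
  fixes act :: "'g \<Rightarrow> 'a \<Rightarrow> 'a" and c :: "'g \<Rightarrow> 'a"
  assumes act_hom: "g \<in> carrier G \<Longrightarrow> act g \<in> hom A A"
    and act_mult: "\<lbrakk>g \<in> carrier G; h \<in> carrier G; x \<in> carrier A\<rbrakk>
      \<Longrightarrow> act (g \<otimes>\<^bsub>G\<^esub> h) x = act g (act h x)"
    and act_one: "x \<in> carrier A \<Longrightarrow> act \<one>\<^bsub>G\<^esub> x = x"
    and c_closed [simp]: "g \<in> carrier G \<Longrightarrow> c g \<in> carrier A"
    and c_mult: "\<lbrakk>g \<in> carrier G; h \<in> carrier G\<rbrakk> \<Longrightarrow> c (g \<otimes>\<^bsub>G\<^esub> h) = c g \<otimes>\<^bsub>A\<^esub> act g (c h)"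
begin

lemma act_closed [simp]: "\<lbrakk>g \<in> carrier G; x \<in> carrier A\<rbrakk> \<Longrightarrow> act g x \<in> carrier A"
  using act_hom hom_in_carrier by fastforce

lemma act_pow:
  assumes "g \<in> carrier G" "x \<in> carrier A"
  shows "act g (x [^]\<^bsub>A\<^esub> (k::nat)) = act g x [^]\<^bsub>A\<^esub> k"
  using hom_nat_pow[OF act_hom[OF assms(1)] assms(2) A.is_group A.is_group] .

lemma c_one: "c \<one>\<^bsub>G\<^esub> = \<one>\<^bsub>A\<^esub>"
proof -
  have "c \<one>\<^bsub>G\<^esub> = c \<one>\<^bsub>G\<^esub> \<otimes>\<^bsub>A\<^esub> c \<one>\<^bsub>G\<^esub>"
    using c_mult[of "\<one>\<^bsub>G\<^esub>" "\<one>\<^bsub>G\<^esub>"] by (simp add: act_one)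
  then show ?thesis by (metis A.l_cancel_one' G.one_closed c_closed)
qed

lemma c_inv:
  assumes g: "g \<in> carrier G"
  shows "c (inv\<^bsub>G\<^esub> g) = inv\<^bsub>A\<^esub> (act (inv\<^bsub>G\<^esub> g) (c g))"
proof -
  have "c (inv\<^bsub>G\<^esub> g) \<otimes>\<^bsub>A\<^esub> act (inv\<^bsub>G\<^esub> g) (c g) = \<one>\<^bsub>A\<^esub>"
    using c_mult[of "inv\<^bsub>G\<^esub> g" g] g by (simp add: c_one)
  then show ?thesis using g by (intro A.inv_equality[symmetric]) auto
qed

text \<open>
  This substitutes for the kernel criterion of homomorphisms: the value of a crossed homomorphism
  at \<open>g\<inverse>h\<close> depends on \<open>h\<close> only through \<open>c h\<close>.
\<close>
lemma inj_on_if_trivial_kernel: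
  assumes ker: "\<And>g. \<lbrakk>g \<in> carrier G; c g = \<one>\<^bsub>A\<^esub>\<rbrakk> \<Longrightarrow> g = \<one>\<^bsub>G\<^esub>"
  shows "inj_on c (carrier G)"
proof (rule inj_onI)
  fix g h assume gh: "g \<in> carrier G" "h \<in> carrier G" "c g = c h"
  have "c (inv\<^bsub>G\<^esub> g \<otimes>\<^bsub>G\<^esub> h) = c (inv\<^bsub>G\<^esub> g \<otimes>\<^bsub>G\<^esub> g)"
    using gh by (simp only: c_mult G.inv_closed)
  then have "inv\<^bsub>G\<^esub> g \<otimes>\<^bsub>G\<^esub> h = \<one>\<^bsub>G\<^esub>" using gh by (intro ker) (auto simp: c_one)
  then show "g = h" using gh by (metis G.inv_equality G.inv_inv G.inv_closed G.inv_comm)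
qed

text \<open>
  A crossed homomorphism is not a homomorphism, so preimages of subgroups are subgroups only
  when the action respects them.
\<close>
lemma subgroup_vimage:
  assumes B: "subgroup B A"
    and inv: "\<And>g x. \<lbrakk>g \<in> carrier G; x \<in> B\<rbrakk> \<Longrightarrow> act g x \<in> B"
  shows "subgroup {g \<in> carrier G. c g \<in> B} G"
proof (rule G.subgroupI)
  show "{g \<in> carrier G. c g \<in> B} \<noteq> {}"
    using subgroup.one_closed[OF B] c_one G.one_closed by force
qed (auto simp: c_inv c_mult inv subgroup.m_inv_closed[OF B] subgroup.m_closed[OF B])

lemma crossed_hom_restrict:
  assumes "subgroup H G"
  shows "crossed_hom (G\<lparr>carrier := H\<rparr>) A act c"
proof -
  interpret H: group "G\<lparr>carrier := H\<rparr>" by (rule G.subgroup_imp_group[OF assms])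
  show ?thesis
    by unfold_locales
      (use subgroup.mem_carrier[OF assms] in \<open>auto simp: act_hom act_mult act_one c_mult\<close>)
qed

lemma crossed_hom_pow: "crossed_hom G A act (\<lambda>g. c g [^]\<^bsub>A\<^esub> (k::nat))"
  by unfold_locales (auto simp: act_hom act_mult act_one c_mult A.nat_pow_distrib act_pow)

text \<open>
  Let \<open>m\<close> be the order and \<open>k\<close> the index of \<open>H\<close>. The elements of \<open>G\<close> that \<open>c\<close> sends into the
  \<open>k\<close>-torsion of \<open>A\<close> form a subgroup. As \<open>c\<close> is bijective, its order is that of the \<open>k\<close>-torsion,
  hence prime to \<open>m\<close>, and so it meets \<open>H\<close> trivially. This makes \<open>h \<mapsto> (c h)\<^sup>k\<close> injective on \<open>H\<close>.
  It is onto because the \<open>k\<close>-th powers have exponent dividing \<open>m\<close>, so that their number divides \<open>m\<close>.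
\<close>
lemma bij_betw_pow_index_Hall:
  assumes bij: "bij_betw c (carrier G) (carrier A)"
    and Hall: "Hall_subgroup H G"
  defines "k \<equiv> card (rcosets\<^bsub>G\<^esub> H)"
  shows "bij_betw (\<lambda>h. c h [^]\<^bsub>A\<^esub> k) H ((\<lambda>x. x [^]\<^bsub>A\<^esub> k) ` carrier A)"
proof -
  have fin: "finite (carrier G)" and H: "subgroup H G" and cop: "coprime (card H) k"
    using Hall by (auto simp: Hall_subgroup_def k_def)
  have finH: "finite H" using subgroup.subset[OF H] fin finite_subset by blast
  have finA: "finite (carrier A)" using bij fin bij_betw_finite by blast
  have "order G = order A" using bij bij_betw_same_card by (auto simp: order_def)
  then have ordA: "order A = k * card H" using G.lagrange[OF H] by (simp add: k_def)
  define T where "T = {x \<in> carrier A. x [^]\<^bsub>A\<^esub> k = \<one>\<^bsub>A\<^esub>}"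
  have T: "subgroup T A"
    unfolding T_def
    by (rule A.subgroupI) (auto simp: A.nat_pow_distrib A.nat_pow_inv)
  define L where "L = {g \<in> carrier G. c g \<in> T}"
  have L: "subgroup L G"
    unfolding L_def
  proof (rule subgroup_vimage[OF T])
    fix g x assume "g \<in> carrier G" "x \<in> T"
    then show "act g x \<in> T"
      using hom_one[OF act_hom A.is_group A.is_group] by (auto simp: T_def act_pow[symmetric])
  qed
  have surj: "c ` carrier G = carrier A" using bij by (rule bij_betw_imp_surj_on)
  have "T \<subseteq> c ` L"
  proof
    fix x assume x: "x \<in> T"
    then have "x \<in> c ` carrier G" using subgroup.mem_carrier[OF T] surj by simp
    then show "x \<in> c ` L" using x unfolding L_def by auto
  qed
  then have "c ` L = T" by (auto simp: L_def)
  moreover have "inj_on c L"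
    using bij_betw_imp_inj_on[OF bij] by (rule inj_on_subset) (simp add: L_def)
  ultimately have cardL: "card L = card T" using card_image by metis
  interpret T: group "A\<lparr>carrier := T\<rparr>" by (rule A.subgroup_imp_group[OF T])
  have "coprime (order (A\<lparr>carrier := T\<rparr>)) (card H)"
  proof (rule T.coprime_order_if_exponent)
    show "finite (carrier (A\<lparr>carrier := T\<rparr>))" using finA by (simp add: T_def)
    show "coprime k (card H)" using cop by (simp add: coprime_commute)
  qed (auto simp: A.nat_pow_consistent[symmetric] T_def)
  then have copL: "coprime (card L) (card H)" by (simp add: order_def cardL)
  have ker: "h = \<one>\<^bsub>G\<^esub>" if h: "h \<in> H" "c h [^]\<^bsub>A\<^esub> k = \<one>\<^bsub>A\<^esub>" for h
  proof -
    have hG: "h \<in> carrier G" using h H subgroup.mem_carrier by metis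
    then have hL: "h \<in> L" using h by (simp add: L_def T_def)
    have dvd: "G.ord h dvd card S" if S: "subgroup S G" "h \<in> S" for S
    proof -
      interpret S: group "G\<lparr>carrier := S\<rparr>" by (rule G.subgroup_imp_group[OF S(1)])
      have "h [^]\<^bsub>G\<lparr>carrier := S\<rparr>\<^esub> card S = \<one>\<^bsub>G\<^esub>"
        using S.pow_order_eq_1[of h] S(2) by (simp add: order_def)
      then show ?thesis using G.pow_eq_id[OF hG] by (simp add: G.nat_pow_consistent[symmetric])
    qed
    have "G.ord h = 1"
      using copL dvd[OF L hL] dvd[OF H h(1)] by (metis coprime_common_divisor_nat)
    then show ?thesis using G.ord_eq_1[OF hG] by simp
  qed
  interpret cH: crossed_hom "G\<lparr>carrier := H\<rparr>" A act "\<lambda>h. c h [^]\<^bsub>A\<^esub> k"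
    using crossed_hom.crossed_hom_pow[OF crossed_hom_restrict[OF H]] .
  have inj: "inj_on (\<lambda>h. c h [^]\<^bsub>A\<^esub> k) H"
    using cH.inj_on_if_trivial_kernel ker by simp
  define B where "B = (\<lambda>x. x [^]\<^bsub>A\<^esub> k) ` carrier A"
  have "group_hom A A (\<lambda>x. x [^]\<^bsub>A\<^esub> k)"
    by unfold_locales (auto simp: hom_def A.nat_pow_distrib)
  then have B: "subgroup B A" unfolding B_def by (rule group_hom.img_is_subgroup)
  interpret B: group "A\<lparr>carrier := B\<rparr>" by (rule A.subgroup_imp_group[OF B])
  have finB: "finite B" using finA by (simp add: B_def)
  have "coprime (order (A\<lparr>carrier := B\<rparr>)) k"
  proof (rule B.coprime_order_if_exponent)
    fix x assume "x \<in> carrier (A\<lparr>carrier := B\<rparr>)"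
    then obtain y where "y \<in> carrier A" "x = y [^]\<^bsub>A\<^esub> k" by (auto simp: B_def)
    then show "x [^]\<^bsub>A\<lparr>carrier := B\<rparr>\<^esub> card H = \<one>\<^bsub>A\<lparr>carrier := B\<rparr>\<^esub>"
      using A.pow_order_eq_1[of y]
      by (simp add: A.nat_pow_consistent[symmetric] A.nat_pow_pow ordA)
  qed (use finB cop in auto)
  then have "coprime (card B) k" by (simp add: order_def)
  moreover have "card B dvd k * card H"
    using A.lagrange[OF B] ordA by (metis dvd_triv_right)
  ultimately have "card B dvd card H" by (simp add: coprime_dvd_mult_right_iff)
  moreover have "card H > 0"
    using finH subgroup.one_closed[OF H] by (auto simp: card_gt_0_iff)
  ultimately have "card B \<le> card H" by (simp add: dvd_imp_le)
  moreover have "(\<lambda>h. c h [^]\<^bsub>A\<^esub> k) ` H \<subseteq> B"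
    using subgroup.mem_carrier[OF H] by (auto simp: B_def)
  ultimately have "(\<lambda>h. c h [^]\<^bsub>A\<^esub> k) ` H = B"
    using finB inj by (intro card_seteq) (auto simp: card_image)
  then show ?thesis using inj by (simp add: bij_betw_def B_def)
qed

end

section \<open>Involutive Yang-Baxter groups and bijective crossed homomorphisms\<close>

lemma Fa_semidirect_Sym_simps [simp]:
  "(a, s) \<in> carrier (Fa_semidirect_Sym n) \<longleftrightarrow> a \<in> carrier (Fa n) \<and> s permutes {1..n}"
  "(a, s) \<otimes>\<^bsub>Fa_semidirect_Sym n\<^esub> (b, t) = (a + basis_action s b, s \<circ> t)"
  "\<one>\<^bsub>Fa_semidirect_Sym n\<^esub> = (0, id)"
  by (simp_all add: Fa_semidirect_Sym_def semidirect_product_def sym_group_def)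

lemma add_closed_Fa: "\<lbrakk>a \<in> carrier (Fa n); b \<in> carrier (Fa n)\<rbrakk> \<Longrightarrow> a + b \<in> carrier (Fa n)"
  using monoid.m_closed[OF group.is_monoid[OF group_free_Abelian_group], of a "{1..n}" b] by simp

lemma hom_sym_group:
  assumes "group G" "\<rho> \<in> hom G (sym_group n)"
  shows "g \<in> carrier G \<Longrightarrow> \<rho> g permutes {1..n}"
    and "\<lbrakk>g \<in> carrier G; h \<in> carrier G\<rbrakk> \<Longrightarrow> \<rho> (g \<otimes>\<^bsub>G\<^esub> h) = \<rho> g \<circ> \<rho> h"
    and "\<rho> \<one>\<^bsub>G\<^esub> = id"
    and "g \<in> carrier G \<Longrightarrow> basis_action (\<rho> (inv\<^bsub>G\<^esub> g)) (basis_action (\<rho> g) a) = a"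
proof -
  show perm: "\<rho> g permutes {1..n}" if "g \<in> carrier G" for g
    using hom_in_carrier[OF assms(2) that] by (simp add: sym_group_carrier)
  show mult: "\<rho> (g \<otimes>\<^bsub>G\<^esub> h) = \<rho> g \<circ> \<rho> h" if "g \<in> carrier G" "h \<in> carrier G" for g h
    using hom_mult[OF assms(2) that] by (simp add: sym_group_mult)
  show one: "\<rho> \<one>\<^bsub>G\<^esub> = id"
    using hom_one[OF assms(2,1) sym_group_is_group] by (simp add: sym_group_one)
  show "basis_action (\<rho> (inv\<^bsub>G\<^esub> g)) (basis_action (\<rho> g) a) = a" if g: "g \<in> carrier G"
    using mult[of "inv\<^bsub>G\<^esub> g" g] g group.l_inv[OF assms(1) g] group.inv_closed[OF assms(1) g]
    by (simp add: one basis_action_comp[symmetric])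
qed

text \<open>
  The map \<open>f\<close> presents the target of \<open>c\<close> as an equivariant image of the permutation module that belongs
  to the faithful permutation representation \<open>\<rho>\<close>. Only the image of \<open>f\<close>, not all of \<open>A\<close>, has to be
  matched by \<open>c\<close>: replacing \<open>c\<close> and \<open>f\<close> by their \<open>k\<close>-th powers then leaves \<open>A\<close> unchanged.
\<close>
locale IYB_cocycle = crossed_hom G A act c
  for G :: "('g, 'm) monoid_scheme" and A :: "('a, 'k) monoid_scheme" and act c +
  fixes n :: nat and \<rho> :: "'g \<Rightarrow> nat \<Rightarrow> nat" and f :: "(nat \<Rightarrow>\<^sub>0 int) \<Rightarrow> 'a"
  assumes degree_pos: "n > 0"
    and \<rho>: "\<rho> \<in> hom G (sym_group n)" "inj_on \<rho> (carrier G)"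
    and f: "f \<in> hom (Fa n) A"
    and f_equivariant: "\<lbrakk>g \<in> carrier G; a \<in> carrier (Fa n)\<rbrakk>
      \<Longrightarrow> f (basis_action (\<rho> g) a) = act g (f a)"
    and bij_c: "bij_betw c (carrier G) (f ` carrier (Fa n))"

text \<open>
  The map to permutations is \<open>\<phi> a = \<rho> (c\<inverse> (f a))\<close>. Equivariance of \<open>f\<close> and the crossed homomorphism law
  give \<open>f (a + \<phi>(a) b) = c (g h)\<close> for \<open>c g = f a\<close> and \<open>c h = f b\<close>, which says that the
  graph of \<open>\<phi>\<close> is closed under multiplication.
\<close>
lemma (in IYB_cocycle) IYB_group:
  assumes fin: "finite (carrier G)"
  shows "IYB_group G"
proof -
  interpret S: group "Fa_semidirect_Sym n" by (rule group_Fa_semidirect_Sym)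
  interpret f: group_hom "Fa n" A f
    using f by (simp add: group_hom_def group_hom_axioms_def A.is_group)
  note \<rho>_simps = hom_sym_group[OF G.is_group \<rho>(1)]
  define d where "d a = inv_into (carrier G) c (f a)" for a
  have d: "d a \<in> carrier G" "c (d a) = f a" if "a \<in> carrier (Fa n)" for a
    using that bij_c by (auto simp: d_def bij_betw_def inv_into_into f_inv_into_f)
  have d_eq: "d a = g" if "g \<in> carrier G" "c g = f a" for a g
    using that bij_c by (auto simp: d_def bij_betw_def intro: inv_into_f_eq)
  define \<phi> where "\<phi> a = \<rho> (d a)" for a
  have act_closed_Fa: "basis_action (\<phi> a) b \<in> carrier (Fa n)"
    if "a \<in> carrier (Fa n)" "b \<in> carrier (Fa n)" for a b
    unfolding \<phi>_def using basis_action_closed[OF \<rho>_simps(1)[OF d(1)[OF that(1)]] that(2)] .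
  have closed: "a + basis_action (\<phi> a) b \<in> carrier (Fa n)"
    if "a \<in> carrier (Fa n)" "b \<in> carrier (Fa n)" for a b
    using add_closed_Fa[OF that(1) act_closed_Fa[OF that]] .
  have \<phi>_mult: "\<phi> (a + basis_action (\<phi> a) b) = \<phi> a \<circ> \<phi> b"
    if ab: "a \<in> carrier (Fa n)" "b \<in> carrier (Fa n)" for a b
  proof -
    have "f (a + basis_action (\<phi> a) b) = f a \<otimes>\<^bsub>A\<^esub> act (d a) (f b)"
      using hom_mult[OF f ab(1) act_closed_Fa[OF ab]] f_equivariant[OF d(1)[OF ab(1)] ab(2)]
      by (simp add: \<phi>_def)
    also have "\<dots> = c (d a \<otimes>\<^bsub>G\<^esub> d b)" using ab by (simp add: c_mult d del: carrier_free_Abelian_group_iff)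
    finally have "d (a + basis_action (\<phi> a) b) = d a \<otimes>\<^bsub>G\<^esub> d b"
      using d(1) ab by (intro d_eq) auto
    then show ?thesis using \<rho>_simps(2) d(1) ab by (simp add: \<phi>_def)
  qed
  let ?graph = "{(a, \<phi> a) |a. a \<in> carrier (Fa n)}"
  have "subgroup ?graph (Fa_semidirect_Sym n)"
  proof (rule S.subgroupI)
    show sub: "?graph \<subseteq> carrier (Fa_semidirect_Sym n)"
      using \<rho>_simps(1) d(1) by (auto simp: \<phi>_def simp del: carrier_free_Abelian_group_iff)
    have "0 \<in> carrier (Fa n)" by simp
    then show "?graph \<noteq> {}" by blast
    show "x \<otimes>\<^bsub>Fa_semidirect_Sym n\<^esub> y \<in> ?graph" if "x \<in> ?graph" "y \<in> ?graph" for x y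
      using that closed \<phi>_mult by (auto simp del: carrier_free_Abelian_group_iff)
    show "inv\<^bsub>Fa_semidirect_Sym n\<^esub> x \<in> ?graph" if x: "x \<in> ?graph" for x
    proof -
      obtain a where a: "x = (a, \<phi> a)" "a \<in> carrier (Fa n)" using x by blast
      define g where "g = d a"
      have g: "g \<in> carrier G" "c g = f a" using d a(2) by (auto simp: g_def)
      \<comment> \<open>The inverse of \<open>(a, s)\<close> in the semidirect product is \<open>(s\<inverse>(-a), s\<inverse>)\<close>; here \<open>s = \<rho> g\<close>.\<close>
      define b where "b = basis_action (\<rho> (inv\<^bsub>G\<^esub> g)) (- a)"
      have ma: "- a \<in> carrier (Fa n)" using a(2) by simp
      have b: "b \<in> carrier (Fa n)"
        unfolding b_def using g(1) by (intro basis_action_closed[OF \<rho>_simps(1)] ma) simp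
      have "f (- a) = inv\<^bsub>A\<^esub> f a" using f.hom_inv[OF a(2)] a(2) by simp
      then have "f b = act (inv\<^bsub>G\<^esub> g) (inv\<^bsub>A\<^esub> c g)"
        using f_equivariant[of "inv\<^bsub>G\<^esub> g" "- a"] ma g by (simp add: b_def)
      also have "\<dots> = c (inv\<^bsub>G\<^esub> g)"
        using group_hom.hom_inv[of A A "act (inv\<^bsub>G\<^esub> g)" "c g"] g(1) act_hom[of "inv\<^bsub>G\<^esub> g"]
        by (simp add: c_inv group_hom_def group_hom_axioms_def A.is_group)
      finally have \<phi>b: "\<phi> b = \<rho> (inv\<^bsub>G\<^esub> g)"
        unfolding \<phi>_def using d_eq[of "inv\<^bsub>G\<^esub> g" b] g(1) by simp
      have "b + basis_action (\<phi> b) a = 0"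
        by (simp add: \<phi>b) (simp add: b_def flip: basis_action_add)
      moreover have "\<phi> b \<circ> \<phi> a = id"
        using \<rho>_simps(2)[of "inv\<^bsub>G\<^esub> g" g] \<rho>_simps(3) g(1)
        by (simp add: \<phi>b) (simp add: \<phi>_def g_def)
      ultimately have "(b, \<phi> b) \<otimes>\<^bsub>Fa_semidirect_Sym n\<^esub> x = \<one>\<^bsub>Fa_semidirect_Sym n\<^esub>"
        by (simp add: a(1))
      moreover have "(b, \<phi> b) \<in> ?graph" using b by blast
      ultimately have "inv\<^bsub>Fa_semidirect_Sym n\<^esub> x = (b, \<phi> b)"
        using sub x by (intro S.inv_equality) (assumption | blast)+
      then show ?thesis using b by blast
    qed
  qed
  moreover have "\<phi> \<in> carrier (Fa n) \<rightarrow> carrier (sym_group n)"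
    using \<rho>_simps(1) d(1) by (auto simp: \<phi>_def sym_group_carrier simp del: carrier_free_Abelian_group_iff)
  moreover have "G \<cong> (sym_group n)\<lparr>carrier := \<phi> ` carrier (Fa n)\<rparr>"
  proof (rule is_isoI)
    have "d ` carrier (Fa n) = carrier G"
    proof
      show "d ` carrier (Fa n) \<subseteq> carrier G" using d(1) by blast
      show "carrier G \<subseteq> d ` carrier (Fa n)"
      proof
        fix g assume g: "g \<in> carrier G"
        then have "c g \<in> f ` carrier (Fa n)" using bij_betw_apply[OF bij_c] by blast
        then show "g \<in> d ` carrier (Fa n)" using d_eq[OF g] by force
      qed
    qed
    then have "\<phi> ` carrier (Fa n) = \<rho> ` carrier G" unfolding \<phi>_def by (metis image_image)
    then show "\<rho> \<in> iso G ((sym_group n)\<lparr>carrier := \<phi> ` carrier (Fa n)\<rparr>)"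
      using \<rho> by (auto simp: iso_def hom_def bij_betw_def)
  qed
  ultimately show ?thesis using degree_pos fin G.is_group unfolding IYB_group_def by blast
qed

text \<open>
  Write \<open>K\<close> for the fibre of \<open>\<phi>\<close> over the identity and \<open>A\<close> for the quotient by \<open>K\<close>. Since the graph of
  \<open>\<phi>\<close> is a subgroup, \<open>\<phi> (a + \<phi>(a) b) = \<phi>(a) \<phi>(b)\<close>. Taking \<open>a\<close> in \<open>K\<close> shows that \<open>\<phi>\<close> is constant on
  cosets of \<open>K\<close>. Taking \<open>\<phi>(a) b\<close> in \<open>K\<close>, and using that the free group is commutative, gives
  \<open>\<phi>(b) = 1\<close>, which is the invariance of \<open>K\<close>; hence also the fibres are single cosets.
  The crossed homomorphism sends \<open>g\<close> to the fibre of \<open>\<phi>\<close> over the permutation \<open>\<rho> g\<close>.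
\<close>
lemma IYB_groupE:
  fixes G :: "('a, 'm) monoid_scheme"
  assumes "IYB_group G"
  obtains n \<rho> and A :: "(nat \<Rightarrow>\<^sub>0 int) set monoid" and act c f
  where "IYB_cocycle G A act c n \<rho> f" "f ` carrier (Fa n) = carrier A"
proof -
  obtain n \<phi> \<rho> where n: "n > 0" and G: "group G"
    and graph: "subgroup {(a, \<phi> a) | a. a \<in> carrier (Fa n)} (Fa_semidirect_Sym n)"
    and \<rho>_iso: "\<rho> \<in> iso G ((sym_group n)\<lparr>carrier := \<phi> ` carrier (Fa n)\<rparr>)"
    and \<phi>: "\<phi> \<in> carrier (Fa n) \<rightarrow> carrier (sym_group n)"
    using assms unfolding IYB_group_def is_iso_def by blast
  interpret G: group G by (rule G)
  interpret F: comm_group "Fa n" by (rule abelian_free_Abelian_group)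
  have \<rho>: "\<rho> \<in> hom G (sym_group n)" "inj_on \<rho> (carrier G)"
    and \<rho>_img: "\<rho> ` carrier G = \<phi> ` carrier (Fa n)"
    using \<rho>_iso \<phi> by (auto simp: iso_def hom_def bij_betw_def Pi_iff image_iff)
  note \<rho>_simps = hom_sym_group[OF G \<rho>(1)]
  have act_Fa: "basis_action (\<rho> g) a \<in> carrier (Fa n)"
    if "g \<in> carrier G" "a \<in> carrier (Fa n)" for g a
    using basis_action_closed[OF \<rho>_simps(1)] that by blast
  have \<rho>_inv: "basis_action (\<rho> g) (basis_action (\<rho> (inv\<^bsub>G\<^esub> g)) a) = a" if "g \<in> carrier G" for g a
    using \<rho>_simps(4)[of "inv\<^bsub>G\<^esub> g" a] that by simp
  have \<phi>_mult: "\<phi> (a + basis_action (\<phi> a) b) = \<phi> a \<circ> \<phi> b"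
    if "a \<in> carrier (Fa n)" "b \<in> carrier (Fa n)" for a b
    using subgroup.m_closed[OF graph, of "(a, \<phi> a)" "(b, \<phi> b)"] that by auto
  have \<phi>_0: "\<phi> 0 = id" using subgroup.one_closed[OF graph] by auto
  have \<phi>_cancel: "\<phi> b = \<phi> c" if "a \<in> carrier (Fa n)" "\<phi> a \<circ> \<phi> b = \<phi> a \<circ> \<phi> c" for a b c
  proof -
    have "inj (\<phi> a)" using \<phi> that(1) permutes_inj sym_group_carrier by blast
    then show ?thesis using that(2) by (simp add: fun.inj_map_strong inj_eq fun_eq_iff)
  qed
  have ex_g: "\<exists>g \<in> carrier G. \<phi> a = \<rho> g" if "a \<in> carrier (Fa n)" for a
    using \<rho>_img that by (metis (no_types, lifting) imageE imageI)
  have ex_a: "\<exists>a \<in> carrier (Fa n). \<phi> a = \<rho> g" if "g \<in> carrier G" for g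
    using \<rho>_img that by (metis (no_types, lifting) imageE imageI)
  define K where "K = {a \<in> carrier (Fa n). \<phi> a = id}"
  have K_sub: "K \<subseteq> carrier (Fa n)" by (auto simp: K_def)
  have \<phi>_add_K: "\<phi> (k + a) = \<phi> a" if "k \<in> K" "a \<in> carrier (Fa n)" for k a
    using \<phi>_mult[of k a] that by (simp add: K_def)
  have K: "subgroup K (Fa n)"
  proof (rule F.subgroupI[OF K_sub])
    show "K \<noteq> {}" using \<phi>_0 by (auto simp: K_def)
    show "inv\<^bsub>Fa n\<^esub> a \<in> K" if a: "a \<in> K" for a
      using \<phi>_add_K[OF a, of "- a"] a \<phi>_0 by (simp add: K_def)
    show "a \<otimes>\<^bsub>Fa n\<^esub> b \<in> K" if a: "a \<in> K" and b: "b \<in> K" for a b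
      using \<phi>_add_K[OF a, of b] add_closed_Fa[of a n b] a b by (simp add: K_def)
  qed
  have K_inv: "basis_action (\<rho> g) k \<in> K" if g: "g \<in> carrier G" and k: "k \<in> K" for g k
  proof -
    obtain b where b: "b \<in> carrier (Fa n)" "\<phi> b = \<rho> (inv\<^bsub>G\<^esub> g)"
      using ex_a[of "inv\<^bsub>G\<^esub> g"] g by auto
    have ak: "basis_action (\<rho> g) k \<in> carrier (Fa n)" using act_Fa g k K_sub by blast
    have "\<phi> b \<circ> \<phi> (basis_action (\<rho> g) k) = \<phi> (b + k)"
      using \<phi>_mult[OF b(1) ak] by (simp add: b(2) \<rho>_simps(4) g)
    also have "\<dots> = \<phi> b \<circ> \<phi> 0"
      using \<phi>_add_K[OF k b(1)] by (simp add: add.commute \<phi>_0)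
    finally have "\<phi> (basis_action (\<rho> g) k) = \<phi> 0" by (rule \<phi>_cancel[OF b(1)])
    then show ?thesis using ak by (simp add: K_def \<phi>_0)
  qed
  interpret K: normal K "Fa n" by (rule F.subgroup_imp_normal[OF K])
  define A where "A = Fa n Mod K"
  define f where "f a = K #>\<^bsub>Fa n\<^esub> a" for a
  define act where "act g C = basis_action (\<rho> g) ` C" for g C
  define c where "c g = {a \<in> carrier (Fa n). \<phi> a = \<rho> g}" for g
  have coset: "f a = (\<lambda>k. k + a) ` K" for a by (auto simp: f_def r_coset_def)
  have f: "f \<in> hom (Fa n) A" unfolding f_def A_def by (rule K.r_coset_hom_Mod)
  have surj: "carrier A = f ` carrier (Fa n)" by (simp add: A_def f_def carrier_FactGroup)
  have equiv: "f (basis_action (\<rho> g) a) = act g (f a)" if g: "g \<in> carrier G" for g a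
  proof -
    have "basis_action (\<rho> g) ` K = K"
    proof
      show "K \<subseteq> basis_action (\<rho> g) ` K"
        using K_inv[of "inv\<^bsub>G\<^esub> g"] \<rho>_inv[OF g] g by (metis G.inv_closed image_eqI subsetI)
    qed (use K_inv g in blast)
    then have "f (basis_action (\<rho> g) a) = (\<lambda>k. k + basis_action (\<rho> g) a) ` basis_action (\<rho> g) ` K"
      by (simp add: coset)
    then show ?thesis by (simp add: act_def coset image_image basis_action_add)
  qed
  have c_eq: "c g = f a" if g: "g \<in> carrier G" and a: "a \<in> carrier (Fa n)" "\<phi> a = \<rho> g" for g a
  proof
    show "f a \<subseteq> c g"
      using \<phi>_add_K[OF _ a(1)] add_closed_Fa[OF _ a(1)] K_sub a(2)
      by (auto simp: coset c_def simp del: carrier_free_Abelian_group_iff)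
    show "c g \<subseteq> f a"
    proof
      fix b assume b: "b \<in> c g"
      \<comment> \<open>Chosen so that \<open>b = a + \<phi>(a) k\<close>; then \<open>\<phi> b = \<phi> a\<close> forces \<open>\<phi> k\<close> to be trivial.\<close>
      define k where "k = basis_action (\<rho> (inv\<^bsub>G\<^esub> g)) (b - a)"
      have "b - a \<in> carrier (Fa n)"
        using add_closed_Fa[of b n "- a"] b a(1) by (simp add: c_def)
      then have k: "k \<in> carrier (Fa n)" using act_Fa g by (simp add: k_def)
      have gk: "basis_action (\<rho> g) k = b - a" by (simp add: k_def \<rho>_inv g)
      then have "\<phi> a \<circ> \<phi> k = \<phi> a \<circ> \<phi> 0"
        using \<phi>_mult[OF a(1) k] a(2) b \<phi>_0 by (simp add: c_def)
      then have "\<phi> k = \<phi> 0" by (rule \<phi>_cancel[OF a(1)])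
      then have "k \<in> K" using \<phi>_0 k by (simp add: K_def)
      then have "b - a \<in> K" using K_inv[OF g] gk by metis
      then show "b \<in> f a" unfolding coset by (rule rev_image_eqI) simp
    qed
  qed
  interpret A: comm_group A unfolding A_def by (rule F.abelian_FactGroup[OF K])
  have "crossed_hom G A act c"
  proof
    fix g assume g: "g \<in> carrier G"
    show "act g \<in> hom A A"
    proof (rule homI)
      fix x assume "x \<in> carrier A"
      then show "act g x \<in> carrier A" using act_Fa[OF g] by (auto simp: surj equiv[OF g, symmetric] simp del: carrier_free_Abelian_group_iff)
    next
      fix x y assume "x \<in> carrier A" "y \<in> carrier A"
      then obtain a b where a: "a \<in> carrier (Fa n)" "x = f a" and b: "b \<in> carrier (Fa n)" "y = f b"
        by (auto simp: surj simp del: carrier_free_Abelian_group_iff)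
      show "act g (x \<otimes>\<^bsub>A\<^esub> y) = act g x \<otimes>\<^bsub>A\<^esub> act g y"
        using hom_mult[OF f a(1) b(1)] hom_mult[OF f act_Fa[OF g a(1)] act_Fa[OF g b(1)]]
          equiv[OF g, of "a + b"]
        by (simp add: a(2) b(2) equiv[OF g, symmetric] basis_action_add)
    qed
    show "c g \<in> carrier A" using ex_a[OF g] c_eq[OF g] surj by auto
    fix h assume h: "h \<in> carrier G"
    show "act (g \<otimes>\<^bsub>G\<^esub> h) x = act g (act h x)" for x
      using g h by (simp add: act_def image_image \<rho>_simps(2) basis_action_comp)
    obtain a b where a: "a \<in> carrier (Fa n)" "\<phi> a = \<rho> g" and b: "b \<in> carrier (Fa n)" "\<phi> b = \<rho> h"
      using ex_a g h by blast
    have "c (g \<otimes>\<^bsub>G\<^esub> h) = f (a + basis_action (\<rho> g) b)"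
      using \<phi>_mult[OF a(1) b(1)] add_closed_Fa[OF a(1) act_Fa[OF g b(1)]] g h
      by (intro c_eq) (auto simp: a(2) b(2) \<rho>_simps(2))
    also have "\<dots> = c g \<otimes>\<^bsub>A\<^esub> act g (c h)"
      using hom_mult[OF f a(1) act_Fa[OF g b(1)]] equiv[OF g] c_eq[OF g a] c_eq[OF h b] by simp
    finally show "c (g \<otimes>\<^bsub>G\<^esub> h) = c g \<otimes>\<^bsub>A\<^esub> act g (c h)" .
  qed (simp add: act_def \<rho>_simps(3))
  moreover have "bij_betw c (carrier G) (carrier A)"
  proof (rule bij_betw_imageI)
    show "inj_on c (carrier G)"
    proof (rule inj_onI)
      fix g h assume gh: "g \<in> carrier G" "h \<in> carrier G" "c g = c h"
      obtain a where "a \<in> c g" using ex_a[OF gh(1)] by (auto simp: c_def)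
      then have "\<rho> g = \<rho> h" using gh(3) by (auto simp: c_def)
      then show "g = h" using \<rho>(2) gh by (auto dest: inj_onD)
    qed
    show "c ` carrier G = carrier A"
    proof
      show "c ` carrier G \<subseteq> carrier A"
      proof (rule image_subsetI)
        fix g assume g: "g \<in> carrier G"
        obtain a where a: "a \<in> carrier (Fa n)" "\<phi> a = \<rho> g" using ex_a[OF g] by blast
        show "c g \<in> carrier A" unfolding c_eq[OF g a] surj using a(1) by (rule imageI)
      qed
      show "carrier A \<subseteq> c ` carrier G"
      proof
        fix x assume "x \<in> carrier A"
        then obtain a where a: "a \<in> carrier (Fa n)" "x = f a" unfolding surj by blast
        then obtain g where "g \<in> carrier G" "\<phi> a = \<rho> g" using ex_g by blast
        then show "x \<in> c ` carrier G" using c_eq[of g a] a by blast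
      qed
    qed
  qed
  ultimately have "IYB_cocycle G A act c n \<rho> f"
    using n \<rho> f surj equiv by (simp add: IYB_cocycle_def IYB_cocycle_axioms_def)
  then show thesis using that surj by metis
qed

section \<open>Hall subgroups of IYB groups\<close>

theorem corollary3p1:
  fixes G :: "('a, 'm) monoid_scheme"
  assumes "IYB_group G"
    and "Hall_subgroup H G"
  shows "IYB_group (G\<lparr>carrier := H\<rparr>)"
proof -
  obtain n \<rho> and A :: "(nat \<Rightarrow>\<^sub>0 int) set monoid" and act c f
    where cocycle: "IYB_cocycle G A act c n \<rho> f" and surj: "f ` carrier (Fa n) = carrier A"
    using IYB_groupE[OF assms(1)] by metis
  interpret IYB_cocycle G A act c n \<rho> f by (rule cocycle)
  have bij: "bij_betw c (carrier G) (carrier A)" using bij_c by (simp only: surj)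
  have H: "subgroup H G" and fin: "finite (carrier G)"
    using assms(2) by (auto simp: Hall_subgroup_def)
  have HG: "H \<subseteq> carrier G" using subgroup.subset[OF H] .
  define k where "k = card (rcosets\<^bsub>G\<^esub> H)"
  have f_closed: "f a \<in> carrier A" if "a \<in> carrier (Fa n)" for a
    using f that by (rule hom_in_carrier)
  interpret pow_H: crossed_hom "G\<lparr>carrier := H\<rparr>" A act "\<lambda>h. c h [^]\<^bsub>A\<^esub> k"
    using crossed_hom.crossed_hom_pow[OF crossed_hom_restrict[OF H]] .
  have "IYB_cocycle (G\<lparr>carrier := H\<rparr>) A act (\<lambda>h. c h [^]\<^bsub>A\<^esub> k) n \<rho> (\<lambda>a. f a [^]\<^bsub>A\<^esub> k)"
  proof
    show "n > 0" by (rule degree_pos)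
    show "\<rho> \<in> hom (G\<lparr>carrier := H\<rparr>) (sym_group n)"
      using \<rho>(1) HG by (auto simp: hom_def)
    show "inj_on \<rho> (carrier (G\<lparr>carrier := H\<rparr>))"
      using inj_on_subset[OF \<rho>(2) HG] by simp
    show "(\<lambda>a. f a [^]\<^bsub>A\<^esub> k) \<in> hom (Fa n) A"
      using f f_closed by (auto simp: hom_def A.nat_pow_distrib)
    show "f (basis_action (\<rho> g) a) [^]\<^bsub>A\<^esub> k = act g (f a [^]\<^bsub>A\<^esub> k)"
      if "g \<in> carrier (G\<lparr>carrier := H\<rparr>)" "a \<in> carrier (Fa n)" for g a
      using that HG f_equivariant[of g a] f_closed[of a] by (auto simp: act_pow)
    have "(\<lambda>a. f a [^]\<^bsub>A\<^esub> k) ` carrier (Fa n) = (\<lambda>x. x [^]\<^bsub>A\<^esub> k) ` carrier A"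
      unfolding surj[symmetric] by (simp only: image_image)
    then show "bij_betw (\<lambda>h. c h [^]\<^bsub>A\<^esub> k) (carrier (G\<lparr>carrier := H\<rparr>))
        ((\<lambda>a. f a [^]\<^bsub>A\<^esub> k) ` carrier (Fa n))"
      using bij_betw_pow_index_Hall[OF bij assms(2)] by (simp add: k_def del: One_nat_def)
  qed
  moreover have "finite (carrier (G\<lparr>carrier := H\<rparr>))" using fin HG finite_subset by auto
  ultimately show ?thesis by (rule IYB_cocycle.IYB_group)
qed

end
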